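(* Let $k$ be a field of characteristic zero. There exist codimension 3 level algebras $A=k[x_1,x_2,x_3]/I$ not enjoying the Weak Lefschetz Property.
   Context: A standard graded artinian algebra is $A=R/I$, where $R=k[x_1,\dots,x_r]$ with all $x_i$ of degree 1 and $I$ is a homogeneous ideal of $R$ containing no non-zero forms of degree at most 1, such that $\dim_k A<\infty$. The $h$-vector of $A$ is $(h_0,h_1,\dots,h_e)$, where $h_i=\dim_k A_i$ and $e$ is the last index with $\dim_k A_e>0$; $e$ is the socle degree of $A$. The codimension of $A$ is $r=h_1$. The socle of $A$ is $\mathrm{soc}(A)=\{a\in A : a\,\overline{m}=0\}$, where $\overline{m}=(\overline{x_1},\dots,\overline{x_r})\subseteq A$; it is a homogeneous ideal. $A$ is level if $\mathrm{soc}(A)_i=0$ for all $i<e$ (equivalently $\mathrm{soc}(A)=A_e$). $A=\bigoplus_{i=0}^e A_i$ enjoys the Weak Lefschetz Property if there exists a linear form $L\in R_1$ such that, for all $i=0,1,\dots,e-1$, the multiplication map $\cdot L: A_i\to A_{i+1}$ has maximal rank as a $k$-linear map (i.e. is injective or surjective). *)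

theory Defs
  imports
    "HOL-Library.Poly_Mapping"
    "HOL-Library.Numeral_Type"
    "HOL-Algebra.QuotRing"
    "HOL-Algebra.Embedded_Algebras"
    "HOL-Algebra.Algebraic_Closure_Type"
begin

text \<open>
  Polynomials over \<^typ>\<open>'k\<close> whose variables are indexed by the finite type \<^typ>\<open>'n\<close>:
  finitely supported maps from exponent vectors to coefficients. The ring structure is that of
  \<^theory>\<open>HOL-Library.Poly_Mapping\<close>, so \<open>('k, 3) mpoly\<close> is \<open>k[x\<^sub>1, x\<^sub>2, x\<^sub>3]\<close>.
\<close>

type_synonym ('k, 'n) mpoly = "('n \<Rightarrow>\<^sub>0 nat) \<Rightarrow>\<^sub>0 'k"

abbreviation mpoly_ring :: "('k::field, 'n::finite) mpoly ring"
  where "mpoly_ring \<equiv> ring_of_type_algebra"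

definition const_poly :: "'k::field \<Rightarrow> ('k, 'n::finite) mpoly"
  where "const_poly c = Poly_Mapping.single 0 c"

definition mpoly_var :: "'n::finite \<Rightarrow> ('k::field, 'n) mpoly"
  where "mpoly_var i = Poly_Mapping.single (Poly_Mapping.single i 1) 1"

definition mon_degree :: "('n::finite \<Rightarrow>\<^sub>0 nat) \<Rightarrow> nat"
  where "mon_degree m = (\<Sum>i\<in>UNIV. Poly_Mapping.lookup m i)"

text \<open>The graded piece \<open>R\<^sub>d\<close>; it contains 0 for every \<open>d\<close>.\<close>

definition forms :: "nat \<Rightarrow> ('k::field, 'n::finite) mpoly set"
  where "forms d = {f. \<forall>m\<in>Poly_Mapping.keys f. mon_degree m = d}"

definition hom_component :: "nat \<Rightarrow> ('k::field, 'n::finite) mpoly \<Rightarrow> ('k, 'n) mpoly"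
  where "hom_component d f =
    (\<Sum>m\<in>{m \<in> Poly_Mapping.keys f. mon_degree m = d}.
       Poly_Mapping.single m (Poly_Mapping.lookup f m))"

definition homogeneous_ideal :: "('k::field, 'n::finite) mpoly set \<Rightarrow> bool"
  where "homogeneous_ideal I \<longleftrightarrow>
    ideal I mpoly_ring \<and> (\<forall>f\<in>I. \<forall>d. hom_component d f \<in> I)"

text \<open>
  Everything below concerns \<open>A = R/I\<close>. Its elements are cosets of \<open>I\<close>; \<open>k\<close> acts on it through
  the classes of the constant polynomials, which form a subfield of \<open>A\<close> as soon as \<open>I\<close> is a
  proper ideal, and all dimensions are taken over that subfield.
\<close>

definition quot_alg :: "('k::field, 'n::finite) mpoly set \<Rightarrow> ('k, 'n) mpoly set ring"
  where "quot_alg I = mpoly_ring Quot I"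

definition quot_class :: "('k::field, 'n::finite) mpoly set \<Rightarrow> ('k, 'n) mpoly \<Rightarrow> ('k, 'n) mpoly set"
  where "quot_class I f = I +>\<^bsub>mpoly_ring\<^esub> f"

definition scalars :: "('k::field, 'n::finite) mpoly set \<Rightarrow> ('k, 'n) mpoly set set"
  where "scalars I = range (\<lambda>c. quot_class I (const_poly c))"

definition graded_piece :: "('k::field, 'n::finite) mpoly set \<Rightarrow> nat \<Rightarrow> ('k, 'n) mpoly set set"
  where "graded_piece I d = quot_class I ` forms d"

definition standard_graded_artinian :: "('k::field, 'n::finite) mpoly set \<Rightarrow> bool"
  where "standard_graded_artinian I \<longleftrightarrow>
    homogeneous_ideal I \<and>
    (\<forall>d\<le>1. \<forall>f\<in>I \<inter> forms d. f = 0) \<and>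
    ring.finite_dimension (quot_alg I) (scalars I) (carrier (quot_alg I))"

definition h_vector :: "('k::field, 'n::finite) mpoly set \<Rightarrow> nat \<Rightarrow> nat"
  where "h_vector I d = ring.dim (quot_alg I) (scalars I) (graded_piece I d)"

definition codimension :: "('k::field, 'n::finite) mpoly set \<Rightarrow> nat"
  where "codimension I = h_vector I 1"

definition socle_degree :: "('k::field, 'n::finite) mpoly set \<Rightarrow> nat"
  where "socle_degree I = (GREATEST d. h_vector I d > 0)"

definition irrelevant_ideal :: "('k::field, 'n::finite) mpoly set \<Rightarrow> ('k, 'n) mpoly set set"
  where "irrelevant_ideal I = genideal (quot_alg I) (range (\<lambda>i. quot_class I (mpoly_var i)))"

definition socle :: "('k::field, 'n::finite) mpoly set \<Rightarrow> ('k, 'n) mpoly set set"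
  where "socle I = {a \<in> carrier (quot_alg I).
    \<forall>b\<in>irrelevant_ideal I. a \<otimes>\<^bsub>quot_alg I\<^esub> b = \<zero>\<^bsub>quot_alg I\<^esub>}"

definition level_algebra :: "('k::field, 'n::finite) mpoly set \<Rightarrow> bool"
  where "level_algebra I \<longleftrightarrow>
    (\<forall>d<socle_degree I. socle I \<inter> graded_piece I d = {\<zero>\<^bsub>quot_alg I\<^esub>})"

definition weak_lefschetz_property :: "('k::field, 'n::finite) mpoly set \<Rightarrow> bool"
  where "weak_lefschetz_property I \<longleftrightarrow>
    (\<exists>L\<in>forms 1. \<forall>d<socle_degree I.
       inj_on (\<lambda>a. quot_class I L \<otimes>\<^bsub>quot_alg I\<^esub> a) (graded_piece I d) \<or>
       (\<lambda>a. quot_class I L \<otimes>\<^bsub>quot_alg I\<^esub> a) ` graded_piece I d = graded_piece I (Suc d))"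

end

theory Submission
  imports Defs "HOL-Analysis.Cartesian_Space"
begin

text \<open>
  The example is the monomial algebra \<open>A = k[x, y, z] / (x\<^sup>3, y\<^sup>3, z\<^sup>3, xyz)\<close>, with \<open>h\<close>-vector
  \<open>(1, 3, 6, 6, 3)\<close>. Every monomial of degree below 4 that survives in \<open>A\<close> has a surviving multiple
  by a variable, so \<open>A\<close> is level. For \<open>L = ax + by + cz\<close> the factorisation
  \<open>u\<^sup>3 + v\<^sup>3 + w\<^sup>3 - 3uvw = (u + v + w)(u\<^sup>2 + v\<^sup>2 + w\<^sup>2 - uv - uw - vw)\<close> with \<open>u = ax\<close>, \<open>v = by\<close>,
  \<open>w = cz\<close> exhibits a quadric killed by \<open>L\<close> in \<open>A\<close>. Hence multiplication by \<open>L\<close> between the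
  6-dimensional pieces of degrees 2 and 3 is not injective; that it is not surjective either is seen
  from an explicit functional on the cubics.
\<close>

section \<open>Quotients by monomial ideals\<close>

lemma mpoly_ring_simps [simp]:
  "carrier mpoly_ring = UNIV" "f \<otimes>\<^bsub>mpoly_ring\<^esub> g = f * g" "f \<oplus>\<^bsub>mpoly_ring\<^esub> g = f + g"
  "\<one>\<^bsub>mpoly_ring\<^esub> = 1" "\<zero>\<^bsub>mpoly_ring\<^esub> = 0"
  by (simp_all add: ring_of_type_algebra_def)

text \<open>Exponent addition is cancellative, so only the summand \<open>l = s\<close> of the
  convolution survives: multiplying by a monomial shifts coefficients.\<close>

lemma lookup_single_mult_shift:
  fixes f :: "('k::field, 'n::finite) mpoly"
  shows "Poly_Mapping.lookup (Poly_Mapping.single s c * f) (s + m) = c * Poly_Mapping.lookup f m"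
proof -
  have "Poly_Mapping.lookup (Poly_Mapping.single s c * f) (s + m) =
      (\<Sum>l. (c * Poly_Mapping.lookup f m) when l = s)"
    unfolding lookup_mult by (rule Sum_any.cong) (auto simp: lookup_single when_def)
  then show ?thesis by simp
qed

lemma lookup_single_mult_eq_0:
  fixes f :: "('k::field, 'n::finite) mpoly"
  assumes "\<And>t. m \<noteq> s + t"
  shows "Poly_Mapping.lookup (Poly_Mapping.single s c * f) m = 0"
  using keys_mult[of "Poly_Mapping.single s c" f] assms
  by (fastforce simp: in_keys_iff lookup_single when_def split: if_splits)

lemma lookup_const_poly_mult [simp]:
  fixes f :: "('k::field, 'n::finite) mpoly"
  shows "Poly_Mapping.lookup (const_poly c * f) m = c * Poly_Mapping.lookup f m"
  using lookup_single_mult_shift[of 0 c f m] by (simp add: const_poly_def)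

lemma lookup_hom_component:
  "Poly_Mapping.lookup (hom_component d f) m =
    (if mon_degree m = d then Poly_Mapping.lookup f m else 0)"
  by (auto simp: hom_component_def lookup_sum lookup_single when_def in_keys_iff
      sum.delta[OF finite_subset[OF _ finite_keys[of f]]])

lemma mon_degree_add: "mon_degree (m + n) = mon_degree m + mon_degree n"
  by (simp add: mon_degree_def lookup_add sum.distrib)

lemma mon_degree_single [simp]: "mon_degree (Poly_Mapping.single i a) = a"
  by (simp add: mon_degree_def lookup_single when_def)

lemma single_1_eq_iff [simp]:
  "Poly_Mapping.single i (Suc 0) = Poly_Mapping.single j (Suc 0) \<longleftrightarrow> i = j"
  by (metis lookup_single_eq lookup_single_not_eq nat.distinct(1))

lemma mon_degree_eq_1_iff: "mon_degree m = 1 \<longleftrightarrow> (\<exists>i. m = Poly_Mapping.single i 1)"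
proof
  assume "mon_degree m = 1"
  then obtain i where "Poly_Mapping.lookup m i = 1" "\<And>j. i \<noteq> j \<Longrightarrow> Poly_Mapping.lookup m j = 0"
    by (metis UNIV_I finite_class.finite_UNIV mon_degree_def sum_eq_1_iff)
  then have "m = Poly_Mapping.single i 1"
    by (intro poly_mapping_eqI) (auto simp: lookup_single when_def)
  then show "\<exists>i. m = Poly_Mapping.single i 1" ..
qed auto

lemma single_in_forms: "mon_degree m = d \<Longrightarrow> Poly_Mapping.single m c \<in> forms d"
  by (simp add: forms_def)

lemma forms_add: "f \<in> forms d \<Longrightarrow> g \<in> forms d \<Longrightarrow> f + g \<in> forms d"
  using keys_add[of f g] by (fastforce simp: forms_def)

lemma forms_diff: "f \<in> forms d \<Longrightarrow> g \<in> forms d \<Longrightarrow> f - g \<in> forms d"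
  using keys_diff[of f g] by (fastforce simp: forms_def)

text \<open>The monomials of degree 1 are exactly the variables, so no other coefficient of
  \<open>L\<close> can be nonzero.\<close>

lemma forms_1_eq_sum:
  assumes "L \<in> forms 1"
  shows "L = (\<Sum>i\<in>UNIV. Poly_Mapping.single (Poly_Mapping.single i 1)
    (Poly_Mapping.lookup L (Poly_Mapping.single i 1)))"
proof (rule poly_mapping_eqI)
  fix m
  show "Poly_Mapping.lookup L m = Poly_Mapping.lookup
    (\<Sum>i\<in>UNIV. Poly_Mapping.single (Poly_Mapping.single i 1)
      (Poly_Mapping.lookup L (Poly_Mapping.single i 1))) m"
  proof (cases "mon_degree m = 1")
    case True
    then obtain i where "m = Poly_Mapping.single i 1"
      using mon_degree_eq_1_iff by blast
    then show ?thesis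
      by (simp add: lookup_sum lookup_single when_def)
  next
    case False
    then have "Poly_Mapping.lookup L m = 0"
      using assms by (auto simp: forms_def in_keys_iff)
    moreover have "m \<noteq> Poly_Mapping.single i 1" for i
      using False by auto
    ultimately show ?thesis
      unfolding lookup_sum by (metis (no_types, lifting) lookup_single_not_eq sum.neutral)
  qed
qed

text \<open>
  \<open>B\<close> consists of the exponents of the monomials that survive in the quotient; the set is an ideal
  only if \<open>B\<close> is closed under divisors.
\<close>

definition monomial_ideal :: "('n::finite \<Rightarrow>\<^sub>0 nat) set \<Rightarrow> ('k::field, 'n) mpoly set"
  where "monomial_ideal B = {f. \<forall>m\<in>B. Poly_Mapping.lookup f m = 0}"

lemma monomial_ideal_add:
  "f \<in> monomial_ideal B \<Longrightarrow> g \<in> monomial_ideal B \<Longrightarrow> f + g \<in> monomial_ideal B"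
  by (simp add: monomial_ideal_def lookup_add)

lemma monomial_ideal_diff:
  "f \<in> monomial_ideal B \<Longrightarrow> g \<in> monomial_ideal B \<Longrightarrow> f - g \<in> monomial_ideal B"
  by (simp add: monomial_ideal_def lookup_minus)

text \<open>Finiteness of \<open>B\<close> makes the quotient finite-dimensional,
  \<open>0 \<in> B\<close> keeps 1 out of the ideal, and \<open>down_closed\<close> is closure under
  divisors.\<close>

locale standard_monomials =
  fixes B :: "('n::finite \<Rightarrow>\<^sub>0 nat) set"
  assumes finite_B: "finite B"
    and zero_in_B: "0 \<in> B"
    and down_closed: "s + m \<in> B \<Longrightarrow> m \<in> B"
begin

text \<open>A monomial of \<open>B\<close> occurring in \<open>g * f\<close> would be a multiple of
  some monomial of \<open>f\<close>; that divisor would lie in \<open>B\<close> too, where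
  \<open>f\<close> has no coefficients.\<close>

lemma mult_in_monomial_ideal:
  assumes "f \<in> monomial_ideal B"
  shows "g * f \<in> monomial_ideal B" "f * g \<in> monomial_ideal B"
proof -
  have "Poly_Mapping.lookup (g * f) m = 0" if "m \<in> B" for m
  proof (rule ccontr)
    assume "Poly_Mapping.lookup (g * f) m \<noteq> 0"
    then obtain s t where "m = s + t" "t \<in> Poly_Mapping.keys f"
      using keys_mult[of g f] by (auto simp: in_keys_iff)
    with \<open>m \<in> B\<close> assms down_closed show False
      by (auto simp: monomial_ideal_def in_keys_iff)
  qed
  then show "g * f \<in> monomial_ideal B" by (simp add: monomial_ideal_def)
  then show "f * g \<in> monomial_ideal B" by (simp add: mult.commute)
qed

lemma ideal_monomial_ideal: "ideal (monomial_ideal B :: ('k::field, 'n) mpoly set) mpoly_ring"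
proof (rule idealI)
  interpret R: ring "mpoly_ring :: ('k, 'n) mpoly ring" ..
  have minus: "\<ominus>\<^bsub>mpoly_ring\<^esub> f = - f" for f :: "('k, 'n) mpoly"
    by (rule R.minus_equality) auto
  show "ring (mpoly_ring :: ('k, 'n) mpoly ring)" ..
  show "subgroup (monomial_ideal B) (add_monoid (mpoly_ring :: ('k, 'n) mpoly ring))"
    by (rule R.add.subgroupI)
      (auto simp: monomial_ideal_def lookup_add minus intro: exI[of _ 0])
qed (simp_all add: mult_in_monomial_ideal)

lemma homogeneous_monomial_ideal: "homogeneous_ideal (monomial_ideal B)"
  using ideal_monomial_ideal
  by (auto simp: homogeneous_ideal_def monomial_ideal_def lookup_hom_component)

section \<open>Computing in the quotient through representatives\<close>

lemma quot_class_hom: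
  "ring_hom_ring (mpoly_ring :: ('k::field, 'n) mpoly ring)
    (quot_alg (monomial_ideal B)) (quot_class (monomial_ideal B))"
  using ideal.rcos_ring_hom_ring[OF ideal_monomial_ideal]
  unfolding quot_alg_def quot_class_def [abs_def] .

lemma ring_quot_alg: "ring (quot_alg (monomial_ideal B))"
  using ring_hom_ring.axioms(2)[OF quot_class_hom] .

lemma quot_alg_simps [simp]:
  fixes f g :: "('k::field, 'n) mpoly"
  shows "carrier (quot_alg (monomial_ideal B)) =
      range (quot_class (monomial_ideal B :: ('k, 'n) mpoly set))"
    and "quot_class (monomial_ideal B) f \<otimes>\<^bsub>quot_alg (monomial_ideal B)\<^esub> quot_class (monomial_ideal B) g =
      quot_class (monomial_ideal B) (f * g)"
    and "quot_class (monomial_ideal B) f \<oplus>\<^bsub>quot_alg (monomial_ideal B)\<^esub> quot_class (monomial_ideal B) g =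
      quot_class (monomial_ideal B) (f + g)"
    and "\<one>\<^bsub>quot_alg (monomial_ideal B)\<^esub> = quot_class (monomial_ideal B) (1 :: ('k, 'n) mpoly)"
    and "\<zero>\<^bsub>quot_alg (monomial_ideal B)\<^esub> = quot_class (monomial_ideal B) (0 :: ('k, 'n) mpoly)"
proof -
  interpret h: ring_hom_ring "mpoly_ring :: ('k, 'n) mpoly ring"
    "quot_alg (monomial_ideal B)" "quot_class (monomial_ideal B)"
    by (rule quot_class_hom)
  show "carrier (quot_alg (monomial_ideal B)) =
      range (quot_class (monomial_ideal B :: ('k, 'n) mpoly set))"
    by (auto simp: quot_alg_def quot_class_def FactRing_def A_RCOSETS_def RCOSETS_def a_r_coset_def)
  show "quot_class (monomial_ideal B) f \<otimes>\<^bsub>quot_alg (monomial_ideal B)\<^esub> quot_class (monomial_ideal B) g =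
      quot_class (monomial_ideal B) (f * g)"
    using h.hom_mult[of f g] by simp
  show "quot_class (monomial_ideal B) f \<oplus>\<^bsub>quot_alg (monomial_ideal B)\<^esub> quot_class (monomial_ideal B) g =
      quot_class (monomial_ideal B) (f + g)"
    using h.hom_add[of f g] by simp
  show "\<one>\<^bsub>quot_alg (monomial_ideal B)\<^esub> = quot_class (monomial_ideal B) (1 :: ('k, 'n) mpoly)"
    using h.hom_one by simp
  show "\<zero>\<^bsub>quot_alg (monomial_ideal B)\<^esub> = quot_class (monomial_ideal B) (0 :: ('k, 'n) mpoly)"
    using h.hom_zero by simp
qed

text \<open>Membership in the ideal only constrains coefficients at \<open>B\<close>. Equations in
  the quotient thereby become comparisons of finitely many coefficients.\<close>

lemma quot_class_monomial_ideal:
  "quot_class (monomial_ideal B) f =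
    {g. \<forall>m\<in>B. Poly_Mapping.lookup g m = Poly_Mapping.lookup f m}"
proof (intro equalityI subsetI)
  fix g assume "g \<in> {g. \<forall>m\<in>B. Poly_Mapping.lookup g m = Poly_Mapping.lookup f m}"
  then have "g - f \<in> monomial_ideal B"
    by (simp add: monomial_ideal_def lookup_minus)
  moreover have "g = (g - f) + f" by simp
  ultimately show "g \<in> quot_class (monomial_ideal B) f"
    by (auto simp: quot_class_def a_r_coset_def r_coset_def intro!: bexI[of _ "g - f"])
qed (auto simp: quot_class_def a_r_coset_def r_coset_def monomial_ideal_def lookup_add)

lemma quot_class_eq_iff:
  "quot_class (monomial_ideal B) f = quot_class (monomial_ideal B) g \<longleftrightarrow>
    (\<forall>m\<in>B. Poly_Mapping.lookup f m = Poly_Mapping.lookup g m)"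
  by (auto simp: quot_class_monomial_ideal)

section \<open>Dimensions of the graded pieces, and the socle\<close>

lemma subfield_scalars:
  "subfield (scalars (monomial_ideal B :: ('k::field, 'n) mpoly set)) (quot_alg (monomial_ideal B))"
proof -
  let ?I = "monomial_ideal B :: ('k, 'n) mpoly set"
  let ?h = "\<lambda>c. quot_class ?I (const_poly c)"
  interpret K: field "ring_of_type_algebra :: 'k ring" ..
  have "?h \<in> ring_hom ring_of_type_algebra (quot_alg ?I)"
    by (rule ring_hom_memI)
      (auto simp: ring_of_type_algebra_def const_poly_def single_add mult_single)
  then interpret h: ring_hom_ring "ring_of_type_algebra :: 'k ring" "quot_alg ?I" ?h
    by (intro ring_hom_ringI2 ring_quot_alg K.ring_axioms)
  \<comment> \<open>The coefficient at the exponent \<open>0 \<in> B\<close> separates 1 from 0, so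
    the image of the field is again a field.\<close>
  have "\<one>\<^bsub>quot_alg ?I\<^esub> \<noteq> \<zero>\<^bsub>quot_alg ?I\<^esub>"
    using zero_in_B by (auto simp: quot_class_eq_iff lookup_one)
  from h.img_is_subfield(2)[OF K.carrier_is_subfield this] show ?thesis
    by (simp add: scalars_def ring_of_type_algebra_def)
qed

text \<open>The monomials with exponents in \<open>S\<close> give a basis: in the induction, each
  new exponent extends the space by one line. The support is constrained only inside
  \<open>B\<close>, since coefficients elsewhere are invisible in the quotient.\<close>

lemma dimension_supported_classes:
  assumes "S \<subseteq> B"
  shows "ring.dimension (quot_alg (monomial_ideal B)) (card S)
    (scalars (monomial_ideal B :: ('k::field, 'n) mpoly set))
    (quot_class (monomial_ideal B) ` {f. Poly_Mapping.keys f \<inter> B \<subseteq> S})"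
  using finite_subset[OF assms finite_B] assms
proof (induction S rule: finite_induct)
  case empty
  let ?I = "monomial_ideal B :: ('k, 'n) mpoly set"
  interpret A: ring "quot_alg ?I" by (rule ring_quot_alg)
  have "quot_class ?I ` {f. Poly_Mapping.keys f \<inter> B \<subseteq> {}} =
      (\<lambda>_. quot_class ?I 0) ` {f :: ('k, 'n) mpoly. Poly_Mapping.keys f \<inter> B \<subseteq> {}}"
    by (intro image_cong refl) (auto simp only: quot_class_eq_iff in_keys_iff lookup_zero)
  also have "\<dots> = {\<zero>\<^bsub>quot_alg ?I\<^esub>}"
    by (auto simp: image_constant_conv intro: exI[of _ 0])
  finally have eq: "quot_class ?I ` {f. Poly_Mapping.keys f \<inter> B \<subseteq> {}} = {\<zero>\<^bsub>quot_alg ?I\<^esub>}" .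
  show ?case unfolding card.empty eq by (rule A.zero_dim)
next
  case (insert s S)
  let ?I = "monomial_ideal B :: ('k, 'n) mpoly set"
  let ?E = "\<lambda>S. quot_class ?I ` {f. Poly_Mapping.keys f \<inter> B \<subseteq> S}"
  let ?v = "quot_class ?I (Poly_Mapping.single s 1)"
  interpret A: ring "quot_alg ?I" by (rule ring_quot_alg)
  \<comment> \<open>Since \<open>s \<in> B\<close>, the coefficient at \<open>s\<close> depends only
    on the class; it is 1 for \<open>?v\<close> and 0 on \<open>?E S\<close>.\<close>
  have "?v \<notin> ?E S"
  proof
    assume "?v \<in> ?E S"
    then obtain f where "?v = quot_class ?I f" "Poly_Mapping.keys f \<inter> B \<subseteq> S"
      by auto
    moreover from this(1) have "Poly_Mapping.lookup f s = 1"
      using insert.prems unfolding quot_class_eq_iff by (metis insert_subset lookup_single_eq)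
    moreover from this have "s \<in> Poly_Mapping.keys f \<inter> B"
      using insert.prems by (simp add: in_keys_iff)
    ultimately show False
      using insert.hyps by blast
  qed
  moreover have "?E (insert s S) = A.line_extension (scalars ?I) ?v (?E S)"
  proof (intro equalityI subsetI)
    fix a assume "a \<in> ?E (insert s S)"
    then obtain f where f: "a = quot_class ?I f" "Poly_Mapping.keys f \<inter> B \<subseteq> insert s S"
      by auto
    let ?c = "const_poly (Poly_Mapping.lookup f s) :: ('k, 'n) mpoly"
    let ?g = "f - ?c * Poly_Mapping.single s 1"
    have "a = quot_class ?I ?c \<otimes>\<^bsub>quot_alg ?I\<^esub> ?v \<oplus>\<^bsub>quot_alg ?I\<^esub> quot_class ?I ?g"
      by (simp add: f)
    moreover have "quot_class ?I ?g \<in> ?E S"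
      using f(2) by (intro imageI) 
        (auto simp: subset_iff in_keys_iff lookup_minus lookup_single when_def split: if_splits)
    moreover have "quot_class ?I ?c \<in> scalars ?I"
      by (simp add: scalars_def)
    ultimately show "a \<in> A.line_extension (scalars ?I) ?v (?E S)"
      unfolding A.line_extension_mem_iff by blast
  next
    fix a assume "a \<in> A.line_extension (scalars ?I) ?v (?E S)"
    then obtain c f where "Poly_Mapping.keys f \<inter> B \<subseteq> S"
      "a = quot_class ?I (const_poly c) \<otimes>\<^bsub>quot_alg ?I\<^esub> ?v \<oplus>\<^bsub>quot_alg ?I\<^esub> quot_class ?I f"
      unfolding A.line_extension_mem_iff by (auto simp: scalars_def)
    then show "a \<in> ?E (insert s S)"
      by (auto intro!: imageI simp: in_keys_iff lookup_add lookup_single when_def split: if_splits)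
  qed
  ultimately show ?case
    using insert A.Suc_dim[of ?v "?E S" "card S" "scalars ?I"] by simp
qed

lemma graded_piece_monomial_ideal:
  "graded_piece (monomial_ideal B) d =
    quot_class (monomial_ideal B) ` {f. Poly_Mapping.keys f \<inter> B \<subseteq> {m\<in>B. mon_degree m = d}}"
proof (intro equalityI subsetI)
  fix a assume "a \<in> quot_class (monomial_ideal B) ` {f. Poly_Mapping.keys f \<inter> B \<subseteq> {m\<in>B. mon_degree m = d}}"
  then obtain f where f: "a = quot_class (monomial_ideal B) f"
    "Poly_Mapping.keys f \<inter> B \<subseteq> {m\<in>B. mon_degree m = d}" by auto
  \<comment> \<open>The terms of \<open>f\<close> of degree other than \<open>d\<close> all lie
    outside \<open>B\<close>, so dropping them does not change the class.\<close>
  have "a = quot_class (monomial_ideal B) (hom_component d f)"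
    using f by (auto simp: quot_class_eq_iff lookup_hom_component in_keys_iff)
  moreover have "hom_component d f \<in> forms d"
    by (auto simp: forms_def in_keys_iff lookup_hom_component split: if_splits)
  ultimately show "a \<in> graded_piece (monomial_ideal B) d"
    by (auto simp: graded_piece_def)
qed (auto simp: graded_piece_def forms_def)

lemma h_vector_monomial_ideal:
  "h_vector (monomial_ideal B :: ('k::field, 'n) mpoly set) d = card {m\<in>B. mon_degree m = d}"
proof -
  interpret A: ring "quot_alg (monomial_ideal B :: ('k, 'n) mpoly set)" by (rule ring_quot_alg)
  show ?thesis
    using A.dimI[OF subfield_scalars dimension_supported_classes[of "{m\<in>B. mon_degree m = d}"]]
    by (simp add: h_vector_def over_def graded_piece_monomial_ideal)
qed

lemma finite_dimension_quot_alg: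
  "ring.finite_dimension (quot_alg (monomial_ideal B))
    (scalars (monomial_ideal B :: ('k::field, 'n) mpoly set)) (carrier (quot_alg (monomial_ideal B)))"
proof -
  interpret A: ring "quot_alg (monomial_ideal B :: ('k, 'n) mpoly set)" by (rule ring_quot_alg)
  show ?thesis
    using A.finite_dimensionI[OF dimension_supported_classes[of B]] by simp
qed

text \<open>Multiplication by the \<open>i\<close>-th variable moves the coefficient at
  \<open>m\<close> to an exponent still in \<open>B\<close>, where the product must vanish.\<close>

lemma socle_coeff_eq_0:
  fixes f :: "('k::field, 'n) mpoly"
  assumes "quot_class (monomial_ideal B) f \<in> socle (monomial_ideal B)"
    and "Poly_Mapping.single i 1 + m \<in> B"
  shows "Poly_Mapping.lookup f m = 0"
proof -
  let ?I = "monomial_ideal B :: ('k, 'n) mpoly set"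
  interpret A: ring "quot_alg ?I" by (rule ring_quot_alg)
  have "quot_class ?I (mpoly_var i) \<in> irrelevant_ideal ?I"
    unfolding irrelevant_ideal_def
    by (rule subsetD[OF A.genideal_self]) auto
  with assms(1) have "quot_class ?I (f * mpoly_var i) = quot_class ?I 0"
    by (auto simp: socle_def)
  with assms(2) have "Poly_Mapping.lookup (mpoly_var i * f) (Poly_Mapping.single i 1 + m) = 0"
    by (auto simp: quot_class_eq_iff mult.commute)
  then show ?thesis
    by (simp only: mpoly_var_def lookup_single_mult_shift) simp
qed

end

text \<open>Only the \<open>i\<close>-th and \<open>j\<close>-th variables divide this monomial,
  with cofactors \<open>e i + e j\<close> and \<open>e i + e i\<close>. In the example below, the
  surviving cubics are exactly the monomials of this shape.\<close>

lemma lookup_linear_mult: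
  fixes L g :: "('k::field, 'n::finite) mpoly"
  assumes "L \<in> forms 1" "i \<noteq> j"
  defines "e \<equiv> \<lambda>i. Poly_Mapping.single i (1::nat)"
  shows "Poly_Mapping.lookup (L * g) (e i + e i + e j) =
    Poly_Mapping.lookup L (e i) * Poly_Mapping.lookup g (e i + e j) +
    Poly_Mapping.lookup L (e j) * Poly_Mapping.lookup g (e i + e i)"
proof -
  let ?c = "\<lambda>k. Poly_Mapping.lookup
    (Poly_Mapping.single (e k) (Poly_Mapping.lookup L (e k)) * g) (e i + e i + e j)"
  have "Poly_Mapping.lookup (L * g) (e i + e i + e j) = (\<Sum>k\<in>UNIV. ?c k)"
    by (subst forms_1_eq_sum[OF assms(1)]) (simp only: sum_distrib_right lookup_sum e_def)
  also have "\<dots> = (\<Sum>k\<in>{i, j}. ?c k)"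
  proof (rule sum.mono_neutral_right)
    show "\<forall>k\<in>UNIV - {i, j}. ?c k = 0"
    proof
      fix k assume "k \<in> UNIV - {i, j}"
      then have "Poly_Mapping.lookup (e i + e i + e j) k = 0"
        by (auto simp: e_def lookup_add lookup_single when_def)
      then have "e i + e i + e j \<noteq> e k + t" for t
        by (metis add_is_0 e_def lookup_add lookup_single_eq one_neq_zero)
      then show "?c k = 0" by (rule lookup_single_mult_eq_0)
    qed
  qed auto
  also have "\<dots> = ?c i + ?c j" using assms(2) by simp
  also have "?c i = Poly_Mapping.lookup L (e i) * Poly_Mapping.lookup g (e i + e j)"
    using lookup_single_mult_shift[of "e i" _ g "e i + e j"] by (simp add: add.assoc)
  also have "?c j = Poly_Mapping.lookup L (e j) * Poly_Mapping.lookup g (e i + e i)"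
    using lookup_single_mult_shift[of "e j" _ g "e i + e i"] by (simp add: add.commute)
  finally show ?thesis .
qed


section \<open>The algebra \<open>k[x, y, z] / (x\<^sup>3, y\<^sup>3, z\<^sup>3, xyz)\<close>\<close>

text \<open>The exponents of the monomials divisible by none of the four generators: the bound 2
  excludes the cubes, a vanishing exponent excludes xyz.\<close>

definition bounded_exponents :: "(3 \<Rightarrow>\<^sub>0 nat) set"
  where "bounded_exponents =
    {m. (\<forall>i. Poly_Mapping.lookup m i \<le> 2) \<and> (\<exists>i. Poly_Mapping.lookup m i = 0)}"

lemma finite_bounded_exponents: "finite bounded_exponents"
proof -
  have "finite (PiE UNIV (\<lambda>_::3. {..2::nat}))"
    by (intro finite_PiE) auto
  moreover have "Poly_Mapping.lookup ` bounded_exponents \<subseteq> PiE UNIV (\<lambda>_. {..2})"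
    by (auto simp: bounded_exponents_def)
  ultimately have "finite (Poly_Mapping.lookup ` bounded_exponents)"
    by (rule finite_subset[rotated])
  then show ?thesis
    by (rule finite_imageD) (auto intro: inj_onI simp: lookup_inject)
qed

interpretation standard_monomials bounded_exponents
proof
  fix s m :: "3 \<Rightarrow>\<^sub>0 nat"
  assume "s + m \<in> bounded_exponents"
  then show "m \<in> bounded_exponents"
    unfolding bounded_exponents_def by (auto simp: lookup_add) (metis add_leD2)
qed (use finite_bounded_exponents in \<open>auto simp: bounded_exponents_def\<close>)

section \<open>Codimension, socle degree and levelness of the example\<close>

lemma mon_degree_3:
  fixes m :: "3 \<Rightarrow>\<^sub>0 nat"
  shows "mon_degree m =
    Poly_Mapping.lookup m 1 + Poly_Mapping.lookup m 2 + Poly_Mapping.lookup m 3"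
  by (simp only: mon_degree_def sum_3)

lemma bounded_exponents_iff:
  "m \<in> bounded_exponents \<longleftrightarrow>
    Poly_Mapping.lookup m 1 \<le> 2 \<and> Poly_Mapping.lookup m 2 \<le> 2 \<and> Poly_Mapping.lookup m 3 \<le> 2 \<and>
    (Poly_Mapping.lookup m 1 = 0 \<or> Poly_Mapping.lookup m 2 = 0 \<or> Poly_Mapping.lookup m 3 = 0)"
  unfolding bounded_exponents_def mem_Collect_eq forall_3 by (metis exhaust_3)

lemma standard_graded_artinian_bounded_exponents:
  "standard_graded_artinian (monomial_ideal bounded_exponents :: ('k::field, 3) mpoly set)"
  unfolding standard_graded_artinian_def
proof (intro conjI allI impI ballI)
  fix d and f :: "('k, 3) mpoly"
  assume d: "d \<le> 1" and f: "f \<in> monomial_ideal bounded_exponents \<inter> forms d"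
  \<comment> \<open>All monomials of degree at most 1 survive, so every coefficient of
    \<open>f\<close> is one that the ideal forces to be 0.\<close>
  have "m \<in> bounded_exponents" if "m \<in> Poly_Mapping.keys f" for m
  proof -
    have "mon_degree m \<le> 1"
      using that f d by (auto simp: forms_def)
    then show ?thesis by (auto simp: bounded_exponents_iff mon_degree_3)
  qed
  then show "f = 0"
    using f by (intro poly_mapping_eqI) (auto simp: monomial_ideal_def in_keys_iff)
qed (rule homogeneous_monomial_ideal finite_dimension_quot_alg)+

lemma codimension_bounded_exponents:
  "codimension (monomial_ideal bounded_exponents :: ('k::field, 3) mpoly set) = 3"
proof -
  have "{m \<in> bounded_exponents. mon_degree m = 1} = range (\<lambda>i. Poly_Mapping.single i 1)"
    by (auto simp: mon_degree_eq_1_iff[simplified] bounded_exponents_iff lookup_single when_def)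
  moreover have "card (range (\<lambda>i::3. Poly_Mapping.single i (1::nat))) = 3"
    by (subst card_image) (auto simp: inj_on_def)
  ultimately show ?thesis
    by (simp add: codimension_def h_vector_monomial_ideal)
qed

lemma socle_degree_bounded_exponents:
  "socle_degree (monomial_ideal bounded_exponents :: ('k::field, 3) mpoly set) = 4"
  unfolding socle_degree_def
proof (rule Greatest_equality)
  \<comment> \<open>The monomial x^2 y^2 attains the top degree: two exponents of at most 2 and a
    third equal to 0 sum to at most 4.\<close>
  let ?m = "Poly_Mapping.single 1 2 + Poly_Mapping.single 2 2 :: 3 \<Rightarrow>\<^sub>0 nat"
  have "?m \<in> {m \<in> bounded_exponents. mon_degree m = 4}"
    by (simp add: bounded_exponents_iff mon_degree_add lookup_add lookup_single)
  then show "0 < h_vector (monomial_ideal bounded_exponents :: ('k, 3) mpoly set) 4"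
    using finite_bounded_exponents by (auto simp: h_vector_monomial_ideal card_gt_0_iff)
next
  fix d assume "0 < h_vector (monomial_ideal bounded_exponents :: ('k, 3) mpoly set) d"
  then obtain m where "m \<in> bounded_exponents" "mon_degree m = d"
    by (auto simp: h_vector_monomial_ideal card_gt_0_iff)
  then show "d \<le> 4" by (auto simp: bounded_exponents_iff mon_degree_3)
qed

text \<open>Some variable is missing from \<open>m\<close>. The other two exponents sum to less than
  4, so one of them is below 2 and can be raised while the missing variable stays missing.\<close>

lemma bounded_exponents_extend:
  assumes "m \<in> bounded_exponents" "mon_degree m < 4"
  shows "\<exists>i. Poly_Mapping.single i 1 + m \<in> bounded_exponents"
proof -
  have "\<exists>i\<in>{1, 2, 3}. Poly_Mapping.single i 1 + m \<in> bounded_exponents"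
    using assms by (auto simp: bounded_exponents_iff mon_degree_3 lookup_add lookup_single when_def)
  then show ?thesis by blast
qed

lemma level_algebra_bounded_exponents:
  "level_algebra (monomial_ideal bounded_exponents :: ('k::field, 3) mpoly set)"
  unfolding level_algebra_def socle_degree_bounded_exponents
proof (intro allI impI)
  let ?I = "monomial_ideal bounded_exponents :: ('k, 3) mpoly set"
  fix d :: nat assume d: "d < 4"
  interpret A: ring "quot_alg ?I" by (rule ring_quot_alg)
  have "a = \<zero>\<^bsub>quot_alg ?I\<^esub>" if a: "a \<in> socle ?I \<inter> graded_piece ?I d" for a
  proof -
    from a obtain f where f: "a = quot_class ?I f" "f \<in> forms d"
      by (auto simp: graded_piece_def)
    have "Poly_Mapping.lookup f m = 0" if m: "m \<in> bounded_exponents" for m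
    proof (cases "mon_degree m = d")
      case True
      with d m obtain i where "Poly_Mapping.single i 1 + m \<in> bounded_exponents"
        using bounded_exponents_extend by blast
      with a f show ?thesis using socle_coeff_eq_0 by blast
    qed (use f(2) in \<open>auto simp: forms_def in_keys_iff\<close>)
    then show ?thesis by (simp add: f quot_class_eq_iff)
  qed
  moreover have "\<zero>\<^bsub>quot_alg ?I\<^esub> \<in> socle ?I"
  proof -
    \<comment> \<open>This places the elements of \<open>irrelevant_ideal\<close> in the carrier, as
      \<open>A.l_null\<close> requires.\<close>
    have "ideal (irrelevant_ideal ?I) (quot_alg ?I)"
      unfolding irrelevant_ideal_def by (intro A.genideal_ideal) auto
    from ideal.Icarr[OF this] show ?thesis
      unfolding socle_def using A.l_null A.zero_closed by blast
  qed
  moreover have "\<zero>\<^bsub>quot_alg ?I\<^esub> \<in> graded_piece ?I d"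
    by (auto simp: graded_piece_def forms_def)
  ultimately show "socle ?I \<inter> graded_piece ?I d = {\<zero>\<^bsub>quot_alg ?I\<^esub>}" by blast
qed

section \<open>Failure of maximal rank from degree 2 to degree 3\<close>

lemma linear_mult_not_injective:
  fixes L :: "('k::field, 3) mpoly"
  defines "I \<equiv> monomial_ideal bounded_exponents :: ('k, 3) mpoly set"
  assumes L: "L \<in> forms 1"
  shows "\<not> inj_on (\<lambda>a. quot_class I L \<otimes>\<^bsub>quot_alg I\<^esub> a) (graded_piece I 2)"
proof -
  define e where "e = (\<lambda>i::3. Poly_Mapping.single i (1::nat))"
  define A where "A = (\<lambda>i. Poly_Mapping.single (e i) (Poly_Mapping.lookup L (e i)))"
  have L_eq: "L = A 1 + A 2 + A 3"
    using forms_1_eq_sum[OF L] by (simp only: A_def e_def sum_3)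
  have AA: "A i * A j = Poly_Mapping.single (e i + e j)
      (Poly_Mapping.lookup L (e i) * Poly_Mapping.lookup L (e j))" for i j
    by (simp add: A_def mult_single)
  note exps = e_def poly_mapping_eq_iff fun_eq_iff forall_3 lookup_add lookup_single when_def
    bounded_exponents_iff
  have "\<exists>g\<in>forms 2. L * g \<in> I \<and> g \<notin> I"
  proof (cases "L = 0")
    \<comment> \<open>For \<open>L = 0\<close> the quadric from the factorisation is itself 0, so
      the surviving square x^2 serves instead.\<close>
    case True
    have "Poly_Mapping.single (e 1 + e 1) (1::'k) \<in> forms 2"
      by (rule single_in_forms) (simp add: mon_degree_add e_def)
    moreover have "Poly_Mapping.single (e 1 + e 1) (1::'k) \<notin> I"
      by (auto simp: I_def monomial_ideal_def exps intro!: bexI[of _ "e 1 + e 1"])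
    ultimately show ?thesis
      using True by (auto simp: I_def monomial_ideal_def)
  next
    case False
    \<comment> \<open>The terms \<open>A 1\<close>, \<open>A 2\<close>, \<open>A 3\<close> of
      \<open>L\<close> play the roles of u, v, w in the factorisation.\<close>
    define g where "g = A 1 * A 1 + A 2 * A 2 + A 3 * A 3 - A 1 * A 2 - A 1 * A 3 - A 2 * A 3"
    have "A i * A j \<in> forms 2" for i j
      unfolding AA by (rule single_in_forms) (simp add: mon_degree_add e_def)
    then have "g \<in> forms 2"
      by (simp add: g_def forms_add forms_diff)
    moreover have "L * g \<in> I"
    proof -
      have "A i * A i * A i \<in> I" for i
        using exhaust_3[of i] unfolding AA
        by (auto simp: I_def monomial_ideal_def A_def mult_single exps)
      moreover have "A 1 * A 2 * A 3 \<in> I"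
        unfolding AA by (auto simp: I_def monomial_ideal_def A_def mult_single exps)
      \<comment> \<open>The term 3uvw is subtracted as three copies, so that closure of the ideal
        under sums and differences suffices.\<close>
      moreover have "L * g = A 1 * A 1 * A 1 + A 2 * A 2 * A 2 + A 3 * A 3 * A 3
          - A 1 * A 2 * A 3 - A 1 * A 2 * A 3 - A 1 * A 2 * A 3"
        by (simp add: L_eq g_def algebra_simps)
      ultimately show ?thesis
        by (simp only: I_def monomial_ideal_add monomial_ideal_diff)
    qed
    moreover have "g \<notin> I"
    proof
      assume g: "g \<in> I"
      \<comment> \<open>The squares of the variables survive, so \<open>g \<in> I\<close> would
        force every coefficient of \<open>L\<close> to square to 0.\<close>
      have square: "Poly_Mapping.lookup g (e i + e i) = (Poly_Mapping.lookup L (e i))\<^sup>2" for i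
        using exhaust_3[of i] unfolding g_def AA
        by (auto simp: lookup_minus exps power2_eq_square)
      have mem: "e i + e i \<in> bounded_exponents" for i
        using exhaust_3[of i] by (auto simp: exps)
      have "Poly_Mapping.lookup L (e i) = 0" for i
        using g mem[of i] square[of i] by (auto simp: I_def monomial_ideal_def)
      then have "A i = 0" for i by (simp add: A_def)
      then have "L = 0" by (subst L_eq) simp
      with False show False ..
    qed
    ultimately show ?thesis by blast
  qed
  then obtain g where g: "g \<in> forms 2" "L * g \<in> I" "g \<notin> I" by blast
  have "quot_class I L \<otimes>\<^bsub>quot_alg I\<^esub> quot_class I g =
      quot_class I L \<otimes>\<^bsub>quot_alg I\<^esub> quot_class I 0"
    unfolding I_def quot_alg_simps quot_class_eq_iff
    using g(2) by (simp add: I_def monomial_ideal_def)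
  moreover have "quot_class I g \<noteq> quot_class I 0"
    unfolding I_def quot_class_eq_iff
    using g(3) by (simp add: I_def monomial_ideal_def)
  moreover have "quot_class I g \<in> graded_piece I 2" "quot_class I 0 \<in> graded_piece I 2"
    using g(1) by (auto simp: graded_piece_def forms_def)
  ultimately show ?thesis by (meson inj_onD)
qed

text \<open>Preimages of the surviving cubics force all products of two distinct coefficients of
  \<open>L\<close> to vanish. Two coefficients are then 0, and the cubics in those two variables
  alone are out of reach.\<close>

lemma linear_mult_not_surjective:
  fixes L :: "('k::field, 3) mpoly"
  defines "I \<equiv> monomial_ideal bounded_exponents :: ('k, 3) mpoly set"
  assumes L: "L \<in> forms 1"
  shows "(\<lambda>a. quot_class I L \<otimes>\<^bsub>quot_alg I\<^esub> a) ` graded_piece I 2 \<noteq> graded_piece I 3"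
proof
  assume surj: "(\<lambda>a. quot_class I L \<otimes>\<^bsub>quot_alg I\<^esub> a) ` graded_piece I 2 = graded_piece I 3"
  define e where "e = (\<lambda>i::3. Poly_Mapping.single i (1::nat))"
  define a where "a = (\<lambda>i. Poly_Mapping.lookup L (e i))"
  \<comment> \<open>Here \<open>c\<close> is the coefficient function of a quadric that
    \<open>L\<close> maps to the class of the monomial \<open>e i + e i + e j\<close>; the equations
    compare coefficients at all six surviving cubics.\<close>
  have preimage: "\<exists>c. \<forall>u v. u \<noteq> v \<longrightarrow>
      a u * c (e u + e v) + a v * c (e u + e u) = (if u = i \<and> v = j then 1 else 0)"
    if "i \<noteq> j" for i j
  proof -
    let ?t = "e i + e i + e j"
    have "Poly_Mapping.single ?t (1::'k) \<in> forms 3"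
      by (rule single_in_forms) (simp add: mon_degree_add e_def)
    then have "quot_class I (Poly_Mapping.single ?t (1::'k)) \<in> graded_piece I 3"
      by (simp add: graded_piece_def)
    then obtain g where "quot_class I (L * g) = quot_class I (Poly_Mapping.single ?t (1::'k))"
      unfolding surj[symmetric] by (auto simp: graded_piece_def I_def)
    then have g: "Poly_Mapping.lookup (L * g) m = Poly_Mapping.lookup (Poly_Mapping.single ?t (1::'k)) m"
      if "m \<in> bounded_exponents" for m
      using that by (auto simp: I_def quot_class_eq_iff)
    have "a u * Poly_Mapping.lookup g (e u + e v) + a v * Poly_Mapping.lookup g (e u + e u) =
        (if u = i \<and> v = j then 1 else 0)" if "u \<noteq> v" for u v
    proof -
      have mem: "e u + e u + e v \<in> bounded_exponents"
        using \<open>u \<noteq> v\<close> exhaust_3[of u] exhaust_3[of v]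
        by (auto simp: bounded_exponents_iff e_def lookup_add lookup_single when_def)
      have "?t = e u + e u + e v \<longleftrightarrow> u = i \<and> v = j"
      proof
        assume eq: "?t = e u + e u + e v"
        \<comment> \<open>The exponents 2 and 1 tell the squared variable from the simple one, so
          the ordered pair can be read off.\<close>
        have "Poly_Mapping.lookup ?t i = 2" "Poly_Mapping.lookup ?t j = 1"
          using \<open>i \<noteq> j\<close> by (simp_all add: e_def lookup_add lookup_single)
        then show "u = i \<and> v = j"
          unfolding eq using \<open>u \<noteq> v\<close>
          by (auto simp: e_def lookup_add lookup_single when_def split: if_splits)
      qed auto
      then show ?thesis
        using g[OF mem] lookup_linear_mult[OF L \<open>u \<noteq> v\<close>, of g]
        by (auto simp: a_def e_def lookup_single when_def)
    qed
    then show ?thesis by blast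
  qed
  have zero: "a j * a k = 0" if "i \<noteq> j" "i \<noteq> k" "j \<noteq> k" for i j k
  proof -
    obtain c where c: "\<And>u v. u \<noteq> v \<Longrightarrow>
      a u * c (e u + e v) + a v * c (e u + e u) = (if u = i \<and> v = j then 1 else 0)"
      using preimage[OF \<open>i \<noteq> j\<close>] by metis
    \<comment> \<open>Six linear equations in the six coefficients of a quadric, one for each
      ordered pair of distinct indices.\<close>
    have eqs: "a i * c (e i + e j) + a j * c (e i + e i) = 1"
      "a j * c (e i + e j) + a i * c (e j + e j) = 0"
      "a i * c (e i + e k) + a k * c (e i + e i) = 0"
      "a k * c (e i + e k) + a i * c (e k + e k) = 0"
      "a j * c (e j + e k) + a k * c (e j + e j) = 0"
      "a k * c (e j + e k) + a j * c (e k + e k) = 0"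
      using c[of i j] c[of j i] c[of i k] c[of k i] c[of j k] c[of k j] that
      by (auto simp: add.commute[of "e _" "e _"])
    \<comment> \<open>The weights \<open>\<plusminus> a v * a w * a w\<close> on \<open>x\<^sub>u\<^sup>2 x\<^sub>v\<close> (\<open>w\<close> the third index)
      define a functional on the cubics that vanishes on all multiples of \<open>L\<close>.\<close>
    have "a j * a k * a k * (a i * c (e i + e j) + a j * c (e i + e i))
        - a i * a k * a k * (a j * c (e i + e j) + a i * c (e j + e j))
        - a j * a j * a k * (a i * c (e i + e k) + a k * c (e i + e i))
        + a i * a j * a j * (a k * c (e i + e k) + a i * c (e k + e k))
        + a i * a i * a k * (a j * c (e j + e k) + a k * c (e j + e j))
        - a i * a i * a j * (a k * c (e j + e k) + a j * c (e k + e k)) = 0"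
      by (simp add: algebra_simps)
    \<comment> \<open>Only the first bracket equals 1 and the others are 0, which leaves
      \<open>a j * a k * a k = 0\<close>.\<close>
    then show ?thesis unfolding eqs by simp
  qed
  \<comment> \<open>All pairwise products vanish, so at most one coefficient of \<open>L\<close> is
    nonzero.\<close>
  have "\<exists>i j. i \<noteq> j \<and> a i = 0 \<and> a j = 0"
    using zero[of 3 1 2] zero[of 2 1 3] zero[of 1 2 3]
    by (cases "a 1 = 0"; cases "a 2 = 0") (force intro: exI[of _ 1] exI[of _ 2] exI[of _ 3])+
  then obtain i j where "i \<noteq> j" "a i = 0" "a j = 0" by blast
  \<comment> \<open>The equation for \<open>u = i\<close>, \<open>v = j\<close> now reads 0 =
    1.\<close>
  with preimage[of i j] show False by force
qed

theorem corollary4: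
  shows "\<exists>I :: ('k::field_char_0, 3) mpoly set.
    standard_graded_artinian I \<and> codimension I = 3 \<and> level_algebra I \<and>
    \<not> weak_lefschetz_property I"
proof (intro exI conjI)
  let ?I = "monomial_ideal bounded_exponents :: ('k, 3) mpoly set"
  show "standard_graded_artinian ?I"
    by (rule standard_graded_artinian_bounded_exponents)
  show "codimension ?I = 3"
    by (rule codimension_bounded_exponents)
  show "level_algebra ?I"
    by (rule level_algebra_bounded_exponents)
  show "\<not> weak_lefschetz_property ?I"
  proof
    assume "weak_lefschetz_property ?I"
    then obtain L :: "('k, 3) mpoly" where L: "L \<in> forms 1" and
      "\<forall>d<4. inj_on (\<lambda>a. quot_class ?I L \<otimes>\<^bsub>quot_alg ?I\<^esub> a) (graded_piece ?I d) \<or>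
        (\<lambda>a. quot_class ?I L \<otimes>\<^bsub>quot_alg ?I\<^esub> a) ` graded_piece ?I d = graded_piece ?I (Suc d)"
      unfolding weak_lefschetz_property_def socle_degree_bounded_exponents by blast
    \<comment> \<open>Degree 2 lies below the socle degree 4, so the property covers the map from
      degree 2 to degree 3.\<close>
    moreover have "(2::nat) < 4" "Suc 2 = (3::nat)" by simp_all
    ultimately show False
      using linear_mult_not_injective[OF L] linear_mult_not_surjective[OF L] by metis
  qed
qed

end
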